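(* Let $\overline{S}=\{S,+,-,\times,\div,0,1\}$ be a field structure, let $p\neq 0$ be a field value in $\overline{S}$, and let $\overline{S}^{p}$ and $\overline{S}_{p}$ be the external and internal representations of the structure scaled by $p$. Then $\overline{S}_{p}$ satisfies the field axioms if and only if $\overline{S}^{p}$ satisfies the field axioms if and only if $\overline{S}$ satisfies the field axioms.
   Context: A field structure is a base set $S$ with binary operations $+,-,\times,\div$ and constants $0,1$ satisfying the field axioms ($-$ is subtraction, $\div$ is division, which is defined for nonzero divisor). Elements of $S$ are identified with their field values in $\overline{S}$; $pa$ means $p\times a$ computed in $\overline{S}$. External representation: $\overline{S}^{p}=\{S,+,-,\frac{\times}{p},p\div,0,p\}$, i.e. the structure on the same set $S$ with the same addition and subtraction as $\overline{S}$, with multiplication $x\,\frac{\times}{p}\,y:=(x\times y)\div p$, division $x\,(p\div)\,y:=p\times(x\div y)$, additive identity $0$ and multiplicative identity $p$ (all right-hand sides computed in $\overline{S}$). Internal representation: $\overline{S}_{p}=\{S,+_{p},-_{p},\times_{p},\div_{p},0_{p},1_{p}\}$ is the same structure with values renamed: the element of $S$ whose value in $\overline{S}$ is $pa$ has value denoted $a_{p}$ in $\overline{S}_{p}$, and the operations and constants are those of $\overline{S}^{p}$ ($+_{p}=+$, $-_{p}=-$, $\times_{p}=\times/p$, $\div_{p}=p\div$, $0_p$ corresponds to $0$, $1_{p}$ corresponds to $p$) transported along this renaming. *)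

theory Defs
  imports "HOL-Algebra.Ring"
begin

text \<open>A structure \<open>{S, +, -, \<times>, \<div>, 0, 1}\<close> carries subtraction and division as primitive
  operations, which the ring record lacks.\<close>

record 'a field_sig = "'a ring" +
  sub :: "'a \<Rightarrow> 'a \<Rightarrow> 'a"
  quot :: "'a \<Rightarrow> 'a \<Rightarrow> 'a"

text \<open>Division is defined only for nonzero divisors, so \<open>quot F x\<close> is unconstrained at \<open>\<zero>\<close>.\<close>

locale field_structure = field F for F :: "('a, 'm) field_sig_scheme" (structure) +
  assumes sub_eq: "\<lbrakk>x \<in> carrier F; y \<in> carrier F\<rbrakk> \<Longrightarrow> sub F x y = x \<ominus> y"
    and quot_eq: "\<lbrakk>x \<in> carrier F; y \<in> carrier F; y \<noteq> \<zero>\<rbrakk> \<Longrightarrow> quot F x y = x \<otimes> inv y"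

definition external_rep :: "'a field_sig \<Rightarrow> 'a \<Rightarrow> 'a field_sig" where
  "external_rep F p =
    \<lparr>carrier = carrier F,
     mult = (\<lambda>x y. quot F (x \<otimes>\<^bsub>F\<^esub> y) p),
     one = p,
     zero = \<zero>\<^bsub>F\<^esub>,
     add = (\<lambda>x y. x \<oplus>\<^bsub>F\<^esub> y),
     sub = sub F,
     quot = (\<lambda>x y. p \<otimes>\<^bsub>F\<^esub> quot F x y)\<rparr>"

text \<open>\<open>Scaled p a\<close> is the value written \<open>a\<^sub>p\<close>: a name, kept distinct from the value \<open>a\<close> of the
  unscaled structure. \<open>elem_of F\<close> sends it to the element of the base set that it names, namely
  the one whose value in \<open>F\<close> is \<open>pa\<close>.\<close>

datatype 'a scaled_value = Scaled 'a 'a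

fun elem_of :: "'a field_sig \<Rightarrow> 'a scaled_value \<Rightarrow> 'a" where
  "elem_of F (Scaled p a) = p \<otimes>\<^bsub>F\<^esub> a"

text \<open>Transport of the structure \<open>F\<close> along the inverse of a renaming \<open>h\<close>, which is meant to be a
  bijection from \<open>A\<close> onto \<open>carrier F\<close>.\<close>

definition transport :: "'b set \<Rightarrow> ('b \<Rightarrow> 'a) \<Rightarrow> 'a field_sig \<Rightarrow> 'b field_sig" where
  "transport A h F =
    \<lparr>carrier = A,
     mult = (\<lambda>u v. inv_into A h (h u \<otimes>\<^bsub>F\<^esub> h v)),
     one = inv_into A h \<one>\<^bsub>F\<^esub>,
     zero = inv_into A h \<zero>\<^bsub>F\<^esub>,
     add = (\<lambda>u v. inv_into A h (h u \<oplus>\<^bsub>F\<^esub> h v)),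
     sub = (\<lambda>u v. inv_into A h (sub F (h u) (h v))),
     quot = (\<lambda>u v. inv_into A h (quot F (h u) (h v)))\<rparr>"

definition internal_rep :: "'a field_sig \<Rightarrow> 'a \<Rightarrow> 'a scaled_value field_sig" where
  "internal_rep F p = transport (Scaled p ` carrier F) (elem_of F) (external_rep F p)"

end

theory Submission
  imports Defs "HOL-Algebra.QuotRing"
begin

text \<open>The scaling map \<open>a \<mapsto> pa\<close> is an isomorphism from \<open>F\<close> onto its external representation: it is a
  bijection of the base set because \<open>p\<close> is invertible, it carries \<open>1\<close> to \<open>p\<close>, and the factors of
  \<open>p\<close> built into the scaled multiplication and division are exactly what makes it multiplicative,
  as \<open>(pa)(pb) / p = p(ab)\<close> and \<open>p((pa) / (pb)) = p(a / b)\<close>. The internal representation is the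
  external one with its elements renamed bijectively, hence isomorphic to it. The
  field axioms are invariant under isomorphism (\<open>field_structure_isomorphic_image\<close>), so they hold
  in all three structures, since they hold in \<open>F\<close>.\<close>

text \<open>Every axiom speaks only of the carrier and the operations, so \<open>h\<close> carries it over from \<open>F\<close>.
  Division by \<open>\<zero>\<close> is left out of the requirements on \<open>h\<close>, because its value is arbitrary on
  both sides and need not correspond. The zero is listed separately because a \<open>ring_iso\<close> is only
  required to preserve sums, products and the unit, and the usual derivation of \<open>h 0 = 0\<close>
  needs cancellation in \<open>G\<close>, which is not yet known to be a group.\<close>

lemma field_structure_isomorphic_image:
  assumes F: "field_structure F"
    and iso: "h \<in> ring_iso F G"
    and zero: "h \<zero>\<^bsub>F\<^esub> = \<zero>\<^bsub>G\<^esub>"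
    and sub: "\<And>x y. \<lbrakk>x \<in> carrier F; y \<in> carrier F\<rbrakk> \<Longrightarrow> h (sub F x y) = sub G (h x) (h y)"
    and quot: "\<And>x y. \<lbrakk>x \<in> carrier F; y \<in> carrier F; y \<noteq> \<zero>\<^bsub>F\<^esub>\<rbrakk>
      \<Longrightarrow> h (quot F x y) = quot G (h x) (h y)"
  shows "field_structure G"
proof -
  interpret F: field_structure F by (rule F)
  have hom: "h \<in> ring_hom F G" and bij: "bij_betw h (carrier F) (carrier G)"
    using iso by (auto simp: ring_iso_def)
  have "field (G\<lparr>zero := h \<zero>\<^bsub>F\<^esub>\<rparr>)"
    using F.ring_iso_imp_img_field[OF iso] .
  then interpret G: field G
    by (simp add: zero)
  interpret h: ring_hom_ring F G h
    by (intro ring_hom_ringI2 F.ring_axioms G.ring_axioms hom)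
  have carrier_G: "carrier G = h ` carrier F"
    using bij by (simp add: bij_betw_def)
  show ?thesis
  proof
    fix u v assume "u \<in> carrier G" "v \<in> carrier G"
    then obtain x y where x: "x \<in> carrier F" "u = h x" and y: "y \<in> carrier F" "v = h y"
      by (auto simp: carrier_G)
    then show "sub G u v = u \<ominus>\<^bsub>G\<^esub> v"
      by (simp add: sub[symmetric] F.sub_eq F.minus_eq G.minus_eq)
  next
    fix u v assume "u \<in> carrier G" "v \<in> carrier G" and "v \<noteq> \<zero>\<^bsub>G\<^esub>"
    then obtain x y where x: "x \<in> carrier F" "u = h x" and y: "y \<in> carrier F" "v = h y"
      by (auto simp: carrier_G)
    with \<open>v \<noteq> \<zero>\<^bsub>G\<^esub>\<close> have y0: "y \<noteq> \<zero>\<^bsub>F\<^esub>"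
      using zero by auto
    with y have unit: "y \<in> Units F"
      by (simp add: F.field_Units)
    have "h y \<otimes>\<^bsub>G\<^esub> h (inv\<^bsub>F\<^esub> y) = \<one>\<^bsub>G\<^esub>"
      using unit y by (simp flip: h.hom_mult)
    then have "inv\<^bsub>G\<^esub> (h y) = h (inv\<^bsub>F\<^esub> y)"
      using unit y by (intro G.comm_inv_char) auto
    with x y y0 unit show "quot G u v = u \<otimes>\<^bsub>G\<^esub> inv\<^bsub>G\<^esub> v"
      by (simp add: quot[symmetric] F.quot_eq)
  qed
qed

text \<open>Renaming the elements of a structure along a bijection changes nothing but the names, since
  the inverse of the renaming is by construction an isomorphism.\<close>

lemma field_structure_transport:
  assumes F: "field_structure F" and bij: "bij_betw h A (carrier F)"
  shows "field_structure (transport A h F)"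
proof (rule field_structure_isomorphic_image[OF F])
  interpret F: field_structure F by (rule F)
  have inverse: "h (inv_into A h x) = x" if "x \<in> carrier F" for x
    using bij that by (rule bij_betw_inv_into_right)
  have bij': "bij_betw (inv_into A h) (carrier F) A"
    using bij by (rule bij_betw_inv_into)
  show "inv_into A h \<in> ring_iso F (transport A h F)"
    using bij' bij_betwE[OF bij']
    by (auto simp: ring_iso_def ring_hom_def transport_def inverse)
  show "inv_into A h \<zero>\<^bsub>F\<^esub> = \<zero>\<^bsub>transport A h F\<^esub>"
    by (simp add: transport_def)
  show "inv_into A h (sub F x y) = sub (transport A h F) (inv_into A h x) (inv_into A h y)"
    if "x \<in> carrier F" "y \<in> carrier F" for x y
    using that by (simp add: transport_def inverse)
  show "inv_into A h (quot F x y) = quot (transport A h F) (inv_into A h x) (inv_into A h y)"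
    if "x \<in> carrier F" "y \<in> carrier F" for x y
    using that by (simp add: transport_def inverse)
qed

context field_structure
begin

lemma scaling_bij_betw:
  assumes "p \<in> carrier F" "p \<noteq> \<zero>"
  shows "bij_betw (\<lambda>a. p \<otimes> a) (carrier F) (carrier F)"
proof (rule bij_betw_byWitness[where f' = "\<lambda>a. inv p \<otimes> a"])
  have "p \<in> Units F"
    using assms by (simp add: field_Units)
  then show "\<forall>a\<in>carrier F. inv p \<otimes> (p \<otimes> a) = a" "\<forall>a\<in>carrier F. p \<otimes> (inv p \<otimes> a) = a"
    "(\<lambda>a. p \<otimes> a) ` carrier F \<subseteq> carrier F" "(\<lambda>a. inv p \<otimes> a) ` carrier F \<subseteq> carrier F"
    using assms by (auto simp flip: m_assoc)
qed

lemma quot_mult_cancel: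
  assumes "p \<in> carrier F" "p \<noteq> \<zero>" "x \<in> carrier F"
  shows "quot F (p \<otimes> x) p = x"
proof -
  have "p \<in> Units F"
    using assms by (simp add: field_Units)
  then have "p \<otimes> x \<otimes> inv p = (p \<otimes> inv p) \<otimes> x"
    using assms by (simp add: m_ac del: Units_r_inv)
  with assms \<open>p \<in> Units F\<close> show ?thesis
    by (simp add: quot_eq)
qed

lemma quot_mult_cancel_both:
  assumes p: "p \<in> carrier F" "p \<noteq> \<zero>" and x: "x \<in> carrier F" and y: "y \<in> carrier F" "y \<noteq> \<zero>"
  shows "quot F (p \<otimes> x) (p \<otimes> y) = quot F x y"
proof -
  have units: "p \<in> Units F" "y \<in> Units F"
    using p y by (simp_all add: field_Units)
  have nz: "p \<otimes> y \<noteq> \<zero>"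
    using p y by (simp add: integral_iff)
  have "(p \<otimes> y) \<otimes> (inv p \<otimes> inv y) = (p \<otimes> inv p) \<otimes> (y \<otimes> inv y)"
    using units p y by (simp add: m_ac del: Units_r_inv)
  then have inv: "inv (p \<otimes> y) = inv p \<otimes> inv y"
    using units p y by (intro comm_inv_char) simp_all
  have "p \<otimes> x \<otimes> inv (p \<otimes> y) = (p \<otimes> inv p) \<otimes> (x \<otimes> inv y)"
    using units p x by (simp add: inv m_ac del: Units_r_inv)
  also have "\<dots> = x \<otimes> inv y"
    using units x by simp
  finally show ?thesis
    using p x y nz by (simp add: quot_eq)
qed

end

lemma field_structure_external_rep:
  assumes F: "field_structure F" and p: "p \<in> carrier F" "p \<noteq> \<zero>\<^bsub>F\<^esub>"
  shows "field_structure (external_rep F p)"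
proof (rule field_structure_isomorphic_image[OF F])
  interpret field_structure F by (rule F)
  show "(\<lambda>a. p \<otimes>\<^bsub>F\<^esub> a) \<in> ring_iso F (external_rep F p)"
  proof -
    \<comment> \<open>The product in \<open>F\<close> of two scaled values carries one factor \<open>p\<close> too many, which the
      division in the scaled product removes.\<close>
    have "quot F ((p \<otimes>\<^bsub>F\<^esub> x) \<otimes>\<^bsub>F\<^esub> (p \<otimes>\<^bsub>F\<^esub> y)) p = p \<otimes>\<^bsub>F\<^esub> (x \<otimes>\<^bsub>F\<^esub> y)"
      if "x \<in> carrier F" "y \<in> carrier F" for x y
    proof -
      have "(p \<otimes>\<^bsub>F\<^esub> x) \<otimes>\<^bsub>F\<^esub> (p \<otimes>\<^bsub>F\<^esub> y) = p \<otimes>\<^bsub>F\<^esub> (p \<otimes>\<^bsub>F\<^esub> (x \<otimes>\<^bsub>F\<^esub> y))"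
        using p that by (simp add: m_ac)
      then show ?thesis
        using p that by (simp add: quot_mult_cancel)
    qed
    with p scaling_bij_betw[OF p] show ?thesis
      by (auto simp: ring_iso_def ring_hom_def external_rep_def r_distr)
  qed
  show "p \<otimes>\<^bsub>F\<^esub> \<zero>\<^bsub>F\<^esub> = \<zero>\<^bsub>external_rep F p\<^esub>"
    using p by (simp add: external_rep_def)
  show "p \<otimes>\<^bsub>F\<^esub> sub F x y = sub (external_rep F p) (p \<otimes>\<^bsub>F\<^esub> x) (p \<otimes>\<^bsub>F\<^esub> y)"
    if "x \<in> carrier F" "y \<in> carrier F" for x y
    using p that by (simp add: external_rep_def sub_eq minus_eq r_distr r_minus)
  show "p \<otimes>\<^bsub>F\<^esub> quot F x y = quot (external_rep F p) (p \<otimes>\<^bsub>F\<^esub> x) (p \<otimes>\<^bsub>F\<^esub> y)"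
    if "x \<in> carrier F" "y \<in> carrier F" "y \<noteq> \<zero>\<^bsub>F\<^esub>" for x y
    using p that by (simp add: external_rep_def quot_mult_cancel_both)
qed

lemma elem_of_bij_betw:
  assumes F: "field_structure F" and p: "p \<in> carrier F" "p \<noteq> \<zero>\<^bsub>F\<^esub>"
  shows "bij_betw (elem_of F) (Scaled p ` carrier F) (carrier F)"
proof -
  have "bij_betw (Scaled p) (carrier F) (Scaled p ` carrier F)"
    by (auto simp: bij_betw_def inj_on_def)
  moreover have "bij_betw (elem_of F \<circ> Scaled p) (carrier F) (carrier F)"
    using field_structure.scaling_bij_betw[OF F p] by (simp add: comp_def)
  ultimately show ?thesis
    using bij_betw_comp_iff by blast
qed

lemma field_structure_internal_rep:
  assumes F: "field_structure F" and p: "p \<in> carrier F" "p \<noteq> \<zero>\<^bsub>F\<^esub>"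
  shows "field_structure (internal_rep F p)"
  unfolding internal_rep_def
proof (rule field_structure_transport)
  show "field_structure (external_rep F p)"
    using assms by (rule field_structure_external_rep)
  show "bij_betw (elem_of F) (Scaled p ` carrier F) (carrier (external_rep F p))"
    using elem_of_bij_betw[OF assms] by (simp add: external_rep_def)
qed

theorem theorem2:
  fixes F :: "'a field_sig" and p :: 'a
  assumes "field_structure F"
    and "p \<in> carrier F"
    and "p \<noteq> \<zero>\<^bsub>F\<^esub>"
  shows "(field_structure (internal_rep F p) \<longleftrightarrow> field_structure (external_rep F p)) \<and>
         (field_structure (external_rep F p) \<longleftrightarrow> field_structure F)"
  using field_structure_internal_rep[OF assms] field_structure_external_rep[OF assms] assms(1)
  by blast

end
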